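(* For every rational number $j/k \in (0,1]$ (with $j,k$ positive coprime integers) there exists a periodic solution of Hamilton's equations for the Kepler–Heisenberg Hamiltonian with rotation number $j/k$: if $T$ is its period, then after time $T/k$ the planet has rotated by angle $2\pi j/k$ counterclockwise about the $z$-axis, i.e. $(x(t+T/k), y(t+T/k))$ is the rotation of $(x(t),y(t))$ by angle $2\pi j/k$ for all $t$.
   Context: Phase space is $T^*\mathbb R^3$ with coordinates $(x,y,z,p_x,p_y,p_z)$. Set $P_X = p_x - \tfrac12 y p_z$, $P_Y = p_y + \tfrac12 x p_z$. The Kepler–Heisenberg Hamiltonian is $H = \tfrac12(P_X^2 + P_Y^2) - \frac{1}{8\pi\sqrt{(x^2+y^2)^2+16z^2}}$, defined away from $x=y=z=0$ (collision). A periodic solution is a collision-free solution defined for all $t\in\mathbb R$ with $c(t+T)=c(t)$ for some $T>0$. *)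

theory Defs
  imports "HOL-Analysis.Analysis"
begin

definition KH_H :: "real \<Rightarrow> real \<Rightarrow> real \<Rightarrow> real \<Rightarrow> real \<Rightarrow> real \<Rightarrow> real" where
  "KH_H x y z px py pz =
     (1/2) * ((px - (1/2) * y * pz)^2 + (py + (1/2) * x * pz)^2)
     - 1 / (8 * pi * sqrt ((x^2 + y^2)^2 + 16 * z^2))"

definition KH_solution ::
  "(real \<Rightarrow> real) \<Rightarrow> (real \<Rightarrow> real) \<Rightarrow> (real \<Rightarrow> real) \<Rightarrow>
   (real \<Rightarrow> real) \<Rightarrow> (real \<Rightarrow> real) \<Rightarrow> (real \<Rightarrow> real) \<Rightarrow> bool" where
  "KH_solution x y z px py pz \<longleftrightarrow>
    (\<forall>t. \<not> (x t = 0 \<and> y t = 0 \<and> z t = 0) \<and>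
      (x has_real_derivative
         deriv (\<lambda>u. KH_H (x t) (y t) (z t) u (py t) (pz t)) (px t)) (at t) \<and>
      (y has_real_derivative
         deriv (\<lambda>u. KH_H (x t) (y t) (z t) (px t) u (pz t)) (py t)) (at t) \<and>
      (z has_real_derivative
         deriv (\<lambda>u. KH_H (x t) (y t) (z t) (px t) (py t) u) (pz t)) (at t) \<and>
      (px has_real_derivative
         - deriv (\<lambda>u. KH_H u (y t) (z t) (px t) (py t) (pz t)) (x t)) (at t) \<and>
      (py has_real_derivative
         - deriv (\<lambda>u. KH_H (x t) u (z t) (px t) (py t) (pz t)) (y t)) (at t) \<and>
      (pz has_real_derivative
         - deriv (\<lambda>u. KH_H (x t) (y t) u (px t) (py t) (pz t)) (z t)) (at t))"

definition KH_periodic_with ::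
  "(real \<Rightarrow> real) \<Rightarrow> (real \<Rightarrow> real) \<Rightarrow> (real \<Rightarrow> real) \<Rightarrow>
   (real \<Rightarrow> real) \<Rightarrow> (real \<Rightarrow> real) \<Rightarrow> (real \<Rightarrow> real) \<Rightarrow> real \<Rightarrow> bool" where
  "KH_periodic_with x y z px py pz s \<longleftrightarrow>
    (\<forall>t. x (t + s) = x t \<and> y (t + s) = y t \<and> z (t + s) = z t \<and>
         px (t + s) = px t \<and> py (t + s) = py t \<and> pz (t + s) = pz t)"

end

theory Submission
  imports Defs
begin

text \<open>On the level $H = 0$ the dilational momentum $J = x p_x + y p_y + 2 z p_z$ is conserved; we
  look for orbits with $H = J = 0$. Put $G = \sqrt{r^4 + 16 z^2}$, $c = r^2/G$, $s = 4z/G$ (so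
  $c = \cos\varphi$, $s = \sin\varphi$ for a latitude $\varphi$) and let $n$ be the angular momentum.
  In the time $\sigma$ with $dt = (G/n)\,d\sigma$ there is a third quantity $S = \varphi_\sigma/2$
  such that
  $c_\sigma = -2sS$, $s_\sigma = 2cS$, $S_\sigma = -(2c+B)s$, $\theta_\sigma = S + s^2/c$,
  with $S^2 = c^2 + Bc - 1$, $G = 2c + B - 2S$ and $B = 1/(4\pi n^2)$. Writing $B = 1/a - a$ and
  using a pendulum phase $u$ with $c = \cos^2 u + a \sin^2 u$, the functions $c$, $s$, $S$, $G$ become
  explicit and $2\pi$-periodic in $u$. In one oscillation the planet turns by an elliptic
  integral which depends continuously on $a$, vanishes at $a = 1$ and is at least
  $2\pi(1 - \sqrt a)$, so it takes every value in $(0, 2\pi)$; the value $2\pi j/k$ gives a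
  solution that closes up after exactly $k$ oscillations. The rotation number $1$ only asks for some
  periodic solution.\<close>

section \<open>Hamilton's equations in cylindrical coordinates\<close>

text \<open>In the rotating frame \<open>P_X\<close>, \<open>P_Y\<close> become \<open>pr\<close>
  (radial) and \<open>n / r + r * pz / 2\<close> (angular). The Hamiltonian is then free of
  \<open>\<theta>\<close>, and the conjugate momentum \<open>n\<close> is a constant. The premises
  are Hamilton's equations of this reduced form; the conclusion rotates back to Cartesian
  coordinates.\<close>

lemma KH_solution_polar:
  fixes r \<theta> z pr pz :: "real \<Rightarrow> real" and n :: real
  defines "\<rho> \<equiv> \<lambda>t. sqrt ((r t)^4 + 16 * (z t)^2)"
  assumes r0: "\<And>t. r t > 0"
    and dr: "\<And>t. (r has_real_derivative pr t) (at t)"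
    and d\<theta>: "\<And>t. (\<theta> has_real_derivative n / (r t)^2 + pz t / 2) (at t)"
    and dz: "\<And>t. (z has_real_derivative n / 2 + (r t)^2 * pz t / 4) (at t)"
    and dpr: "\<And>t. (pr has_real_derivative
        n^2 / (r t)^3 - r t * (pz t)^2 / 4 - (r t)^3 / (4 * pi * (\<rho> t)^3)) (at t)"
    and dpz: "\<And>t. (pz has_real_derivative - 2 * z t / (pi * (\<rho> t)^3)) (at t)"
  shows "KH_solution (\<lambda>t. r t * cos (\<theta> t)) (\<lambda>t. r t * sin (\<theta> t)) z
    (\<lambda>t. pr t * cos (\<theta> t) - n / r t * sin (\<theta> t))
    (\<lambda>t. pr t * sin (\<theta> t) + n / r t * cos (\<theta> t)) pz"
  unfolding KH_solution_def
proof (intro allI conjI)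
  fix t
  define R Q Z C S where defs: "R = r t" "Q = \<rho> t" "Z = z t" "C = cos (\<theta> t)" "S = sin (\<theta> t)"
  have R: "R > 0" using r0 defs by simp
  have CS: "C^2 = 1 - S^2" unfolding defs by (simp add: cos_squared_eq)
  have pos: "R^4 + 16 * Z^2 > 0" using R by (simp add: add_pos_nonneg)
  have Q: "Q > 0" and Q2: "Q^2 = R^4 + 16 * Z^2"
    using pos unfolding defs \<rho>_def by auto
  have xy: "(R * C)^2 + (R * S)^2 = R^2"
    using CS by algebra
  have xy4: "((R * C)^2 + (R * S)^2)^2 + 16 * Z^2 = R^4 + 16 * Z^2"
    unfolding xy by simp
  have sq: "sqrt (R^4 + 16 * Z^2) = Q" unfolding defs \<rho>_def ..
  show "\<not> (r t * cos (\<theta> t) = 0 \<and> r t * sin (\<theta> t) = 0 \<and> z t = 0)"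
    using r0[of t] sin_zero_abs_cos_one by fastforce
  \<comment> \<open>Only the value of the radicand \<open>h\<close> at \<open>u0\<close> is fixed,
    so one computation serves the forces in all three coordinate directions.\<close>
  have potential: "((\<lambda>u. 1 / (8 * pi * sqrt (h u))) has_real_derivative
      - h' / (16 * pi * Q^3)) (at u0)"
    if "(h has_real_derivative h') (at u0)" "h u0 = R^4 + 16 * Z^2" for h h' u0
  proof -
    have "h u0 > 0" "sqrt (h u0) = Q" using that pos sq by auto
    then show ?thesis using Q
      by (auto intro!: derivative_eq_intros that simp: divide_simps power3_eq_cube)
  qed
  have Hderiv: "deriv (\<lambda>u. f u - 1 / (8 * pi * sqrt (h u))) u0 = f' + h' / (16 * pi * Q^3)"
    if "(f has_real_derivative f') (at u0)" "(h has_real_derivative h') (at u0)"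
      "h u0 = R^4 + 16 * Z^2" for f f' h h' u0
    using DERIV_imp_deriv[OF DERIV_diff[OF that(1) potential[OF that(2,3)]]] by simp
  have Hpx: "deriv (\<lambda>u. KH_H x y zz u py pz) px = px - y * pz / 2" for x y zz px py pz :: real
    unfolding KH_H_def
    by (intro DERIV_imp_deriv) (auto intro!: derivative_eq_intros simp: field_simps)
  have Hpy: "deriv (\<lambda>u. KH_H x y zz px u pz) py = py + x * pz / 2" for x y zz px py pz :: real
    unfolding KH_H_def
    by (intro DERIV_imp_deriv) (auto intro!: derivative_eq_intros simp: field_simps)
  have Hpz: "deriv (\<lambda>u. KH_H x y zz px py u) pz
      = - (px - y * pz / 2) * y / 2 + (py + x * pz / 2) * x / 2" for x y zz px py pz :: real
    unfolding KH_H_def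
    by (intro DERIV_imp_deriv) (auto intro!: derivative_eq_intros simp: field_simps)
  have Hx: "deriv (\<lambda>u. KH_H u (R * S) Z px py pz) (R * C)
      = (py + R * C * pz / 2) * pz / 2 + R^3 * C / (4 * pi * Q^3)" for px py pz :: real
  proof -
    have h: "((\<lambda>u. (u^2 + (R * S)^2)^2 + 16 * Z^2) has_real_derivative 4 * R^3 * C) (at (R * C))"
      by (auto intro!: derivative_eq_intros simp: xy) (simp add: power2_eq_square power3_eq_cube)
    have f: "((\<lambda>u. 1 / 2 * ((px - 1 / 2 * (R * S) * pz)^2 + (py + 1 / 2 * u * pz)^2))
        has_real_derivative (py + R * C * pz / 2) * pz / 2) (at (R * C))"
      by (auto intro!: derivative_eq_intros)
    show ?thesis
      unfolding KH_H_def using Hderiv[OF f h xy4] by (simp add: mult.commute mult.left_commute)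
  qed
  have Hy: "deriv (\<lambda>u. KH_H (R * C) u Z px py pz) (R * S)
      = (R * S * pz / 2 - px) * pz / 2 + R^3 * S / (4 * pi * Q^3)" for px py pz :: real
  proof -
    have h: "((\<lambda>u. ((R * C)^2 + u^2)^2 + 16 * Z^2) has_real_derivative 4 * R^3 * S) (at (R * S))"
      by (auto intro!: derivative_eq_intros simp: xy) (simp add: power2_eq_square power3_eq_cube)
    have f: "((\<lambda>u. 1 / 2 * ((px - 1 / 2 * u * pz)^2 + (py + 1 / 2 * (R * C) * pz)^2))
        has_real_derivative (R * S * pz / 2 - px) * pz / 2) (at (R * S))"
      by (auto intro!: derivative_eq_intros simp: field_simps)
    show ?thesis
      unfolding KH_H_def using Hderiv[OF f h xy4] by (simp add: mult.commute mult.left_commute)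
  qed
  have Hz: "deriv (\<lambda>u. KH_H (R * C) (R * S) u px py pz) Z = 2 * Z / (pi * Q^3)"
    for px py pz :: real
  proof -
    have h: "((\<lambda>u. ((R * C)^2 + (R * S)^2)^2 + 16 * u^2) has_real_derivative 32 * Z) (at Z)"
      by (auto intro!: derivative_eq_intros)
    show ?thesis
      unfolding KH_H_def using Hderiv[OF DERIV_const h xy4] by (simp add: mult.commute mult.left_commute)
  qed
  show "((\<lambda>t. r t * cos (\<theta> t)) has_real_derivative
      deriv (\<lambda>u. KH_H (r t * cos (\<theta> t)) (r t * sin (\<theta> t)) (z t) u
         (pr t * sin (\<theta> t) + n / r t * cos (\<theta> t)) (pz t))
         (pr t * cos (\<theta> t) - n / r t * sin (\<theta> t))) (at t)"
    unfolding Hpx using r0[of t]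
    by (auto intro!: derivative_eq_intros dr d\<theta> simp: field_simps power2_eq_square)
  show "((\<lambda>t. r t * sin (\<theta> t)) has_real_derivative
      deriv (\<lambda>u. KH_H (r t * cos (\<theta> t)) (r t * sin (\<theta> t)) (z t)
         (pr t * cos (\<theta> t) - n / r t * sin (\<theta> t)) u (pz t))
         (pr t * sin (\<theta> t) + n / r t * cos (\<theta> t))) (at t)"
    unfolding Hpy using r0[of t]
    by (auto intro!: derivative_eq_intros dr d\<theta> simp: field_simps power2_eq_square)
  \<comment> \<open>Writing \<open>n = e * R\<close> removes the division: the equation for
    \<open>z\<close> becomes a polynomial identity modulo \<open>C^2 + S^2 = 1\<close>.\<close>
  define e where "e = n / R"
  have e: "n = e * R" using R by (simp add: e_def)
  show "(z has_real_derivative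
      deriv (\<lambda>u. KH_H (r t * cos (\<theta> t)) (r t * sin (\<theta> t)) (z t)
         (pr t * cos (\<theta> t) - n / r t * sin (\<theta> t))
         (pr t * sin (\<theta> t) + n / r t * cos (\<theta> t)) u) (pz t)) (at t)"
    unfolding Hpz defs[symmetric] e_def[symmetric]
  proof (rule DERIV_cong[OF dz])
    have "2 * n + R^2 * pz t = - (2 * (pr t * C - e * S) - R * S * pz t) * (R * S)
        + (2 * (pr t * S + e * C) + R * C * pz t) * (R * C)"
      using CS e by algebra
    then show "n / 2 + (r t)^2 * pz t / 4 =
        - (pr t * C - e * S - R * S * pz t / 2) * (R * S) / 2
        + (pr t * S + e * C + R * C * pz t / 2) * (R * C) / 2"
      unfolding defs(1)[symmetric] by (simp add: field_simps)
  qed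
  show "((\<lambda>t. pr t * cos (\<theta> t) - n / r t * sin (\<theta> t)) has_real_derivative
      - deriv (\<lambda>u. KH_H u (r t * sin (\<theta> t)) (z t)
         (pr t * cos (\<theta> t) - n / r t * sin (\<theta> t))
         (pr t * sin (\<theta> t) + n / r t * cos (\<theta> t)) (pz t)) (r t * cos (\<theta> t))) (at t)"
    unfolding Hx[unfolded defs] using r0[of t] Q[unfolded defs]
    by (auto intro!: derivative_eq_intros dr dpr d\<theta>)
       (simp add: field_simps power2_eq_square power3_eq_cube)
  show "((\<lambda>t. pr t * sin (\<theta> t) + n / r t * cos (\<theta> t)) has_real_derivative
      - deriv (\<lambda>u. KH_H (r t * cos (\<theta> t)) u (z t)
         (pr t * cos (\<theta> t) - n / r t * sin (\<theta> t))
         (pr t * sin (\<theta> t) + n / r t * cos (\<theta> t)) (pz t)) (r t * sin (\<theta> t))) (at t)"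
    unfolding Hy[unfolded defs] using r0[of t] Q[unfolded defs]
    by (auto intro!: derivative_eq_intros dr dpr d\<theta>)
       (simp add: field_simps power2_eq_square power3_eq_cube)
  show "(pz has_real_derivative
      - deriv (\<lambda>u. KH_H (r t * cos (\<theta> t)) (r t * sin (\<theta> t)) u
         (pr t * cos (\<theta> t) - n / r t * sin (\<theta> t))
         (pr t * sin (\<theta> t) + n / r t * cos (\<theta> t)) (pz t)) (z t)) (at t)"
    unfolding Hz[unfolded defs] using dpz[of t] by simp
qed

section \<open>Periodic functions: antiderivatives and change of time\<close>

text \<open>By periodicity \<open>F (u + p) - F u\<close> has derivative zero, so it keeps its value
  at 0. Applied to the drift this yields the rotation per oscillation, applied to a clock rate the
  duration of an oscillation.\<close>

lemma periodic_antiderivative: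
  fixes f :: "real \<Rightarrow> real"
  assumes cont: "continuous_on UNIV f" and per: "\<And>u. f (u + p) = f u" and p: "p > 0"
  obtains F where "\<And>u. (F has_real_derivative f u) (at u)"
    "\<And>u. F (u + p) = F u + integral {0..p} f"
proof -
  obtain F where dF: "\<And>u. (F has_real_derivative f u) (at u)"
    using einterval_antiderivative[of "-\<infinity>" \<infinity> f] cont
    by (auto simp: continuous_on_eq_continuous_at has_real_derivative_iff_has_vector_derivative)
  have "(f has_integral (F p - F 0)) {0..p}"
    using p dF by (intro fundamental_theorem_of_calculus)
      (auto simp: has_real_derivative_iff_has_vector_derivative[symmetric]
        intro: has_field_derivative_at_within)
  then have int: "integral {0..p} f = F p - F 0" by (rule integral_unique)
  have "F (u + p) = F u + integral {0..p} f" for u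
  proof -
    have "((\<lambda>u. F (u + p) - F u) has_real_derivative 0) (at v)" for v
      using DERIV_shift[THEN iffD1, OF dF[of "v + p"]] dF[of v]
      by (auto intro!: derivative_eq_intros simp: per)
    then have "F (u + p) - F u = F (0 + p) - F 0" by (rule DERIV_isconst_all[rule_format])
    then show ?thesis by (simp add: int)
  qed
  with dF show thesis using that by blast
qed

text \<open>Here \<open>f\<close> is the rate dt/du of time against phase. Its antiderivative
  \<open>F\<close> is time as a function of phase, and \<open>\<Psi>\<close> is the inverse of
  \<open>F\<close>: phase as a function of time. The shift rule of \<open>F\<close> turns into that
  of \<open>\<Psi>\<close>.\<close>

lemma periodic_time_change:
  fixes f :: "real \<Rightarrow> real"
  assumes cont: "continuous_on UNIV f" and pos: "\<And>u. f u > 0"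
    and per: "\<And>u. f (u + p) = f u" and p: "p > 0"
  obtains \<Psi> :: "real \<Rightarrow> real" and T :: real
  where "T > 0" "strict_mono \<Psi>"
    "\<And>t. (\<Psi> has_real_derivative 1 / f (\<Psi> t)) (at t)" "\<And>t. \<Psi> (t + T) = \<Psi> t + p"
proof -
  obtain F where dF: "\<And>u. (F has_real_derivative f u) (at u)"
    and shift: "\<And>u. F (u + p) = F u + integral {0..p} f"
    using periodic_antiderivative[OF cont per p] by blast
  have mono: "strict_mono F"
    unfolding strict_mono_def using dF pos by (meson DERIV_pos_imp_increasing)
  have contF: "isCont F u" for u using dF DERIV_isCont by blast
  define T where "T = integral {0..p} f"
  have "F 0 < F (0 + p)" using mono p by (simp add: strict_mono_def)
  then have T: "T > 0" unfolding shift T_def by simp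
  note shift = shift[folded T_def]
  have shift_nat: "F (u + of_nat m * p) = F u + of_nat m * T" for u m
  proof (induction m)
    case (Suc m)
    then show ?case using shift[of "u + of_nat m * p"] by (simp add: algebra_simps)
  qed simp
  \<comment> \<open>\<open>F\<close> gains the same \<open>T > 0\<close> in every period, so it
    passes each level; hence \<open>\<Psi>\<close> is meaningful for all times.\<close>
  have surj: "\<exists>u. F u = t" for t
  proof -
    obtain m :: nat where m: "\<bar>t - F 0\<bar> < m * T"
      using T reals_Archimedean3 by blast
    have "F (- (m * p)) = F 0 - m * T" "F (m * p) = F 0 + m * T"
      using shift_nat[of "- (m * p)" m] shift_nat[of 0 m] by auto
    then have "F (- (m * p)) \<le> t" "t \<le> F (m * p)" using m by auto
    moreover have "- (m * p) \<le> m * p" using p by simp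
    ultimately show ?thesis using IVT[of F "- (m * p)" t "m * p"] contF by auto
  qed
  define \<Psi> where "\<Psi> = inv F"
  have inj: "inj F" using mono by (rule strict_mono_imp_inj_on)
  have \<Psi>F: "\<Psi> (F u) = u" for u using inj by (simp add: \<Psi>_def)
  have F\<Psi>: "F (\<Psi> t) = t" for t
    using surj unfolding \<Psi>_def by (metis f_inv_into_f rangeI)
  show thesis
  proof
    show "T > 0" by fact
    show "strict_mono \<Psi>"
      unfolding strict_mono_def using mono F\<Psi> by (metis strict_mono_less)
    show "\<Psi> (t + T) = \<Psi> t + p" for t using shift[of "\<Psi> t"] F\<Psi> \<Psi>F by metis
    have "isCont \<Psi> t" for t
      using isCont_inverse_function[of 1 "\<Psi> t" \<Psi> F] \<Psi>F F\<Psi> contF by auto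
    then show "(\<Psi> has_real_derivative 1 / f (\<Psi> t)) (at t)" for t
      using DERIV_inverse_function[OF dF, of \<Psi> t "t - 1" "t + 1"] F\<Psi>
        less_imp_neq[OF pos, symmetric]
      by (simp add: divide_inverse)
  qed
qed

section \<open>Reconstruction of the orbit from the latitude variables\<close>

text \<open>The difference of \<open>(2 * c + B)^2\<close> and \<open>(2 * S)^2\<close> is the
  positive constant \<open>B^2 + 4\<close>. Positivity of G keeps the orbit away from
  collision.\<close>

lemma scale_factor_pos:
  fixes c S B :: real
  assumes "c > 0" "B > 0" "S^2 = c^2 + B * c - 1"
  shows "2 * c + B - 2 * S > 0"
proof -
  have "(2 * c + B)^2 = (2 * S)^2 + (B^2 + 4)" using assms(3) by algebra
  then have "(2 * S)^2 < (2 * c + B)^2" by (simp add: add_nonneg_pos)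
  then have "2 * S < 2 * c + B" by (rule power2_less_imp_less) (use assms in simp)
  then show ?thesis by simp
qed

text \<open>The factor \<open>n / G t\<close> is the rate of the auxiliary time sigma against t. The
  formulas invert the change of variables: \<open>r^2 = G * c\<close> and
  \<open>4 * z = G * s\<close> give \<open>sqrt (r^4 + 16 * z^2) = G\<close>; the choice of
  \<open>pr\<close> and \<open>pz\<close> gives J = 0; and with \<open>4 * pi * n^2 * B = 1\<close>
  the relation for \<open>S^2\<close> expresses H = 0.\<close>

lemma KH_solution_reduced:
  fixes c s S \<theta> :: "real \<Rightarrow> real" and n B :: real
  defines "G \<equiv> \<lambda>t. 2 * c t + B - 2 * S t"
  assumes c0: "\<And>t. c t > 0"
    and cs: "\<And>t. (c t)^2 + (s t)^2 = 1"
    and S2: "\<And>t. (S t)^2 = (c t)^2 + B * c t - 1"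
    and n: "4 * pi * n^2 * B = 1"
    and dc: "\<And>t. (c has_real_derivative - 2 * s t * S t * n / G t) (at t)"
    and ds: "\<And>t. (s has_real_derivative 2 * c t * S t * n / G t) (at t)"
    and dS: "\<And>t. (S has_real_derivative - (2 * c t + B) * s t * n / G t) (at t)"
    and d\<theta>: "\<And>t. (\<theta> has_real_derivative (S t + (s t)^2 / c t) * n / G t) (at t)"
  defines "r \<equiv> \<lambda>t. sqrt (G t * c t)"
  defines "pr \<equiv> \<lambda>t. n * s t * (c t - S t) / r t"
  shows "KH_solution (\<lambda>t. r t * cos (\<theta> t)) (\<lambda>t. r t * sin (\<theta> t)) (\<lambda>t. G t * s t / 4)
    (\<lambda>t. pr t * cos (\<theta> t) - n / r t * sin (\<theta> t))
    (\<lambda>t. pr t * sin (\<theta> t) + n / r t * cos (\<theta> t)) (\<lambda>t. 2 * n * (S t - c t) / G t)"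
proof -
  have B: "B > 0"
  proof (rule ccontr)
    assume "\<not> B > 0"
    then have "4 * pi * n^2 * B \<le> 0" by (intro mult_nonneg_nonpos) auto
    then show False using n by simp
  qed
  have G0: "G t > 0" for t
    unfolding G_def using scale_factor_pos[OF c0 B S2] .
  have r0: "r t > 0" and r2: "(r t)^2 = G t * c t" for t
    using G0[of t] c0[of t] by (auto simp: r_def)
  \<comment> \<open>With respect to sigma the derivative of \<open>G\<close> is
    \<open>2 * s * G\<close>, so the denominator cancels in time t.\<close>
  have dG: "(G has_real_derivative 2 * s t * n) (at t)" for t
  proof -
    have "2 * (- 2 * s t * S t * n / G t) - 2 * (- (2 * c t + B) * s t * n / G t)
      = 2 * s t * n * ((2 * c t + B - 2 * S t) / G t)"
      by (simp add: diff_divide_distrib add_divide_distrib algebra_simps)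
    also have "\<dots> = 2 * s t * n" using G0[of t] unfolding G_def by simp
    finally have eq: "2 * (- 2 * s t * S t * n / G t) - 2 * (- (2 * c t + B) * s t * n / G t)
      = 2 * s t * n" .
    have "((\<lambda>t. 2 * c t + B - 2 * S t) has_real_derivative 2 * (- 2 * s t * S t * n / G t) + 0
        - 2 * (- (2 * c t + B) * s t * n / G t)) (at t)"
      by (intro DERIV_diff DERIV_add DERIV_cmult DERIV_const dc dS)
    then show ?thesis using eq by (simp only: G_def add_0_right)
  qed
  have \<rho>: "sqrt ((r t)^4 + 16 * (G t * s t / 4)^2) = G t" for t
  proof -
    have "(r t)^4 = (G t * c t)^2" using r2[of t] by algebra
    then have "(r t)^4 + 16 * (G t * s t / 4)^2 = (G t * c t)^2 + (G t * s t)^2"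
      by (simp add: power_divide)
    also have "\<dots> = (G t)^2" using cs[of t] by algebra
    finally show ?thesis using G0[of t] by simp
  qed
  show ?thesis
  \<comment> \<open>In the premises that contain it, the root is replaced by \<open>G t\<close>; the
    question mark admits the others.\<close>
  proof (rule KH_solution_polar; (unfold \<rho>)?)
    fix t
    define c1 s1 S1 G1 R where defs: "c1 = c t" "s1 = s t" "S1 = S t" "G1 = G t" "R = r t"
    have pos: "R > 0" "G1 > 0" "c1 > 0" using r0 G0 c0 by (simp_all add: defs)
    have R2: "R^2 = G1 * c1" using r2 by (simp add: defs)
    have G1: "G1 = 2 * c1 + B - 2 * S1" by (simp add: defs G_def)
    have rel: "S1^2 = c1^2 + B * c1 - 1" "c1^2 + s1^2 = 1" using S2 cs by (simp_all add: defs)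
    show "r t > 0" by fact
    show dr: "(r has_real_derivative pr t) (at t)"
    proof -
      have "((\<lambda>t. sqrt (G t * c t)) has_real_derivative inverse (sqrt (G t * c t)) / 2 *
          (2 * s t * n * c t + - 2 * s t * S t * n / G t * G t)) (at t)"
        using G0[of t] c0[of t] by (intro DERIV_chain2[OF DERIV_real_sqrt] DERIV_mult dG dc) simp
      moreover have "2 * s1 * n * c1 + - 2 * s1 * S1 * n / G1 * G1 = 2 * (n * s1 * (c1 - S1))"
        using pos by (simp add: algebra_simps)
      moreover have "inverse R / 2 * (2 * v) = v / R" for v
        by (simp add: field_simps)
      ultimately show ?thesis unfolding defs pr_def by (simp only: r_def)
    qed
    show "(\<theta> has_real_derivative n / (r t)^2 + 2 * n * (S t - c t) / G t / 2) (at t)"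
    proof (rule DERIV_cong[OF d\<theta>])
      have "(S1 * c1 + s1^2) = 1 + (S1 - c1) * c1" using rel by algebra
      then have eq: "S1 + s1^2 / c1 = 1 / c1 + (S1 - c1)" using pos by (simp add: field_simps)
      show "(S t + (s t)^2 / c t) * n / G t = n / (r t)^2 + 2 * n * (S t - c t) / G t / 2"
        unfolding defs[symmetric] R2 eq using pos by (simp add: field_simps)
    qed
    show "((\<lambda>t. G t * s t / 4) has_real_derivative
        n / 2 + (r t)^2 * (2 * n * (S t - c t) / G t) / 4) (at t)"
    proof (rule DERIV_cong[OF DERIV_cdivide[OF DERIV_mult[OF dG ds]]])
      have "2 * s1 * n * s1 + 2 * c1 * S1 * n = 2 * n + c1 * 2 * n * (S1 - c1)"
        using rel by algebra
      moreover have "2 * c1 * S1 * n / G1 * G1 = 2 * c1 * S1 * n" using pos by simp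
      moreover have "n / 2 + G1 * c1 * (2 * n * (S1 - c1) / G1) / 4 = (2 * n + c1 * 2 * n * (S1 - c1)) / 4"
        using pos by (simp add: field_simps)
      ultimately show "(2 * s t * n * s t + 2 * c t * S t * n / G t * G t) / 4
          = n / 2 + (r t)^2 * (2 * n * (S t - c t) / G t) / 4"
        unfolding defs[symmetric] R2 by (simp only:)
    qed
    show "(pr has_real_derivative n^2 / (r t)^3 - r t * (2 * n * (S t - c t) / G t)^2 / 4
        - (r t)^3 / (4 * pi * (G t)^3)) (at t)"
    proof -
      have "- 2 * s1 * S1 * n / G1 - - (2 * c1 + B) * s1 * n / G1
          = s1 * n * ((2 * c1 + B - 2 * S1) / G1)"
        by (simp add: diff_divide_distrib add_divide_distrib algebra_simps)
      then have eq: "- 2 * s1 * S1 * n / G1 - - (2 * c1 + B) * s1 * n / G1 = s1 * n"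
        using pos unfolding G1[symmetric] by simp
      have "((\<lambda>t. n * s t * (c t - S t)) has_real_derivative
          n * (2 * c1 * S1 * n / G1) * (c1 - S1) +
          (- 2 * s1 * S1 * n / G1 - - (2 * c1 + B) * s1 * n / G1) * (n * s1)) (at t)"
        unfolding defs by (intro DERIV_mult DERIV_cmult DERIV_diff dc ds dS)
      then have dN: "((\<lambda>t. n * s t * (c t - S t)) has_real_derivative
          n^2 * (2 * c1 * S1 * (c1 - S1) / G1 + s1^2)) (at t)"
        unfolding eq by (rule DERIV_cong) (simp add: power2_eq_square ring_distribs mult_ac)
      \<comment> \<open>For \<open>pr = N / r\<close> the quotient rule gives
        \<open>(N' * r^2 - N^2) / r^3\<close>; this is its numerator. It splits into three terms,
        which after division by \<open>R^3\<close> are the centrifugal term, the \<open>pz^2\<close>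
        term and the attraction, the last one through \<open>n^2 * B = 1 / (4 * pi)\<close>.\<close>
      have "n^2 * (2 * c1 * S1 * (c1 - S1) / G1 + s1^2) * R^2 - (n * s1 * (c1 - S1))^2
          = n^2 * (2 * c1^2 * S1 * (c1 - S1) + c1 * s1^2 * G1 - s1^2 * (c1 - S1)^2)"
        unfolding R2 using pos by (simp add: field_simps power2_eq_square)
      also have "2 * c1^2 * S1 * (c1 - S1) + c1 * s1^2 * G1 - s1^2 * (c1 - S1)^2
          = 1 - c1^2 * (S1 - c1)^2 - c1^3 * B"
        using rel G1 by algebra
      finally have key: "n^2 * (2 * c1 * S1 * (c1 - S1) / G1 + s1^2) * R^2 - (n * s1 * (c1 - S1))^2
          = n^2 * (1 - c1^2 * (S1 - c1)^2 - c1^3 * B)" .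
      have sq: "R * (2 * n * v / G1)^2 / 4 = n^2 * (R * v^2 / G1^2)" for v
        by (simp add: power_mult_distrib power_divide)
      have c1: "c1 = R^2 / G1" using R2 pos by simp
      have "(n^2 * (2 * c1 * S1 * (c1 - S1) / G1 + s1^2) * R - n * s1 * (c1 - S1) * (n * s1 * (c1 - S1) / R))
            / (R * R)
          = (n^2 * (2 * c1 * S1 * (c1 - S1) / G1 + s1^2) * R^2 - (n * s1 * (c1 - S1))^2) / R^3"
        using pos by (simp add: field_simps power2_eq_square power3_eq_cube)
      also have "\<dots> = n^2 / R^3 - n^2 * (R * (S1 - c1)^2 / G1^2) - (n^2 * B) * (R^3 / G1^3)"
        unfolding key using pos unfolding c1
        by (simp add: field_simps power2_eq_square power3_eq_cube)
      also have "n^2 * B = 1 / (4 * pi)" using n by (simp add: field_simps)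
      finally have "(n^2 * (2 * c1 * S1 * (c1 - S1) / G1 + s1^2) * R - n * s1 * (c1 - S1) * (n * s1 * (c1 - S1) / R))
            / (R * R) = n^2 / R^3 - R * (2 * n * (S1 - c1) / G1)^2 / 4 - R^3 / (4 * pi * G1^3)"
        unfolding sq by (simp add: mult_ac)
      with DERIV_divide[OF dN dr] pos show ?thesis
        unfolding pr_def defs by simp
    qed
    show "((\<lambda>t. 2 * n * (S t - c t) / G t) has_real_derivative
        - 2 * (G t * s t / 4) / (pi * (G t)^3)) (at t)"
    proof -
      have "((\<lambda>t. 2 * n * (S t - c t) / G t) has_real_derivative
          ((2 * n * (- (2 * c t + B) * s t * n / G t - - 2 * s t * S t * n / G t)) * G t
            - 2 * n * (S t - c t) * (2 * s t * n)) / (G t * G t)) (at t)"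
        using G0[of t] by (intro DERIV_divide DERIV_cmult DERIV_diff dG dc dS) simp
      \<comment> \<open>Since \<open>G1 + 2 * (S1 - c1) = B\<close>, the numerator of the quotient
        rule collapses to a multiple of \<open>s1\<close>.\<close>
      moreover have "2 * n * (- (2 * c1 + B) * s1 * n / G1 - - 2 * s1 * S1 * n / G1) * G1
            - 2 * n * (S1 - c1) * (2 * s1 * n) = - 2 * (n^2 * B) * s1"
        using pos by (simp add: field_simps) (simp add: G1 power2_eq_square algebra_simps)
      moreover have "n^2 * B = 1 / (4 * pi)" using n by (simp add: field_simps)
      moreover have "- 2 * (1 / (4 * pi)) * s1 / (G1 * G1) = - 2 * (G1 * s1 / 4) / (pi * G1^3)"
        using pos by (simp add: field_simps power3_eq_cube)
      ultimately show ?thesis unfolding defs by simp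
    qed
  qed
qed

section \<open>The explicit oscillation and its total drift\<close>

text \<open>The cosine of the latitude at pendulum phase $u$; it oscillates between $a$ and $1$.\<close>

definition cos_lat :: "real \<Rightarrow> real \<Rightarrow> real" where
  "cos_lat a u = (cos u)^2 + a * (sin u)^2"

text \<open>The term $s^2/c$ of the angular velocity, with respect to $u$. The other term $S$ has the
  periodic antiderivative $\varphi/2$ and does not contribute to the rotation.\<close>

definition drift :: "real \<Rightarrow> real \<Rightarrow> real" where
  "drift a u = sqrt a * (1 - cos_lat a u) * sqrt (1 + cos_lat a u)
     / (cos_lat a u * sqrt (1 + a * cos_lat a u))"

lemma cos_lat_bounds:
  assumes "0 < a" "a \<le> 1"
  shows "a \<le> cos_lat a u" "cos_lat a u \<le> 1" "cos_lat a u > 0"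
proof -
  have "cos_lat a u = a + (1 - a) * (cos u)^2"
    unfolding cos_lat_def using sin_cos_squared_add[of u] by algebra
  then show "a \<le> cos_lat a u" using assms by simp
  have "cos_lat a u = 1 - (1 - a) * (sin u)^2"
    unfolding cos_lat_def using sin_cos_squared_add[of u] by algebra
  then show "cos_lat a u \<le> 1" using assms by simp
  show "cos_lat a u > 0" using \<open>a \<le> cos_lat a u\<close> assms by simp
qed

text \<open>This elementary integral bounds the elliptic integral of the drift from below.\<close>

lemma has_integral_inverse_cos_lat:
  assumes "0 < a"
  shows "((\<lambda>u. sqrt a / cos_lat a u) has_integral 2 * pi) {0..2 * pi}"
proof -
  define q where "q = sqrt a"
  have q: "q > 0" "a = q^2" using assms by (auto simp: q_def)
  \<comment> \<open>The obvious primitive \<open>arctan (q * tan u)\<close> jumps at the poles of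
    the tangent. By the subtraction formula for tangents, \<open>P\<close> is its smooth
    continuation: the arctan term is periodic and all growth sits in \<open>u\<close>.\<close>
  define P where
    "P u = u - arctan ((1 - q) * (sin u * cos u) / ((cos u)^2 + q * (sin u)^2))" for u
  have "(P has_real_derivative q / cos_lat a u) (at u)" for u
  proof -
    define C S where "C = cos u" "S = sin u"
    have CS: "C^2 + S^2 = 1" by (simp add: C_S_def)
    have D: "C^2 + q * S^2 > 0"
      using CS q by (smt (verit) mult_pos_pos mult_nonneg_nonneg zero_le_power2 zero_less_power2)
    have E: "C^2 + q^2 * S^2 > 0"
      using CS q by (smt (verit) mult_pos_pos mult_nonneg_nonneg zero_le_power2 zero_less_power2)
    have "(P has_real_derivative 1 - ((1 - q) * (C * C - S * S) * (C^2 + q * S^2)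
          - (1 - q) * (S * C) * (2 * q * S * C - 2 * C * S)) / (C^2 + q * S^2)^2
          / (1 + ((1 - q) * (S * C) / (C^2 + q * S^2))^2)) (at u)"
      unfolding P_def C_S_def using D[unfolded C_S_def]
      by (auto intro!: derivative_eq_intros simp: field_simps power2_eq_square)
    moreover have "(C^2 + q * S^2)^2 * (1 + ((1 - q) * (S * C) / (C^2 + q * S^2))^2)
        = C^2 + q^2 * S^2"
    proof -
      have "(C^2 + q * S^2)^2 * (1 + ((1 - q) * (S * C) / (C^2 + q * S^2))^2)
          = (C^2 + q * S^2)^2 + ((1 - q) * (S * C))^2"
        using D by (simp add: field_simps)
      also have "\<dots> = C^2 + q^2 * S^2" using CS by algebra
      finally show ?thesis .
    qed
    moreover have "(1 - q) * (C * C - S * S) * (C^2 + q * S^2)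
        - (1 - q) * (S * C) * (2 * q * S * C - 2 * C * S) = C^2 + q^2 * S^2 - q"
      using CS by algebra
    ultimately have "(P has_real_derivative 1 - (C^2 + q^2 * S^2 - q) / (C^2 + q^2 * S^2)) (at u)"
      by simp
    then show ?thesis
      using E by (simp add: cos_lat_def q C_S_def diff_divide_distrib)
  qed
  then have "((\<lambda>u. q / cos_lat a u) has_integral (P (2 * pi) - P 0)) {0..2 * pi}"
    by (intro fundamental_theorem_of_calculus)
      (auto simp: has_real_derivative_iff_has_vector_derivative[symmetric]
        intro: has_field_derivative_at_within)
  then show ?thesis by (simp add: P_def q_def)
qed

text \<open>Joint continuity makes the integral over \<open>u\<close> continuous in
  \<open>a\<close>. The value \<open>a = 0\<close> is excluded because \<open>cos_lat 0\<close> has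
  zeros; \<open>a = 1\<close> is included as an endpoint for the intermediate value theorem.\<close>

lemma continuous_on_drift: "continuous_on ({0<..1} \<times> UNIV) (\<lambda>(a, u). drift a u)"
proof -
  have "cos_lat a u * sqrt (1 + a * cos_lat a u) \<noteq> 0" if "0 < a" "a \<le> 1" for a u
    using cos_lat_bounds[OF that, of u] that by (auto simp: add_pos_pos less_imp_neq[symmetric] add_pos_nonneg)
  then show ?thesis
    unfolding drift_def case_prod_unfold
    by (intro continuous_intros) (auto simp: cos_lat_def intro!: continuous_intros)
qed

lemma continuous_on_drift_slice:
  assumes "0 < a" "a \<le> 1"
  shows "continuous_on A (drift a)"
proof -
  have "continuous_on A (\<lambda>u. (a, u))" by (intro continuous_intros)
  moreover have "(\<lambda>u. (a, u)) ` A \<subseteq> {0<..1} \<times> UNIV" using assms by auto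
  ultimately show ?thesis using continuous_on_compose2[OF continuous_on_drift] by fastforce
qed

lemma total_drift_attained:
  assumes "0 < \<alpha>" "\<alpha> < 2 * pi"
  obtains a where "0 < a" "a < 1" "integral {0..2 * pi} (drift a) = \<alpha>"
proof -
  \<comment> \<open>Chosen so that the lower bound \<open>2 * pi * (1 - sqrt a)\<close> equals
    \<open>\<alpha>\<close> at \<open>a = q^2\<close>.\<close>
  define q where "q = 1 - \<alpha> / (2 * pi)"
  have q: "0 < q" "q < 1" using assms by (auto simp: q_def)
  have q2: "0 < q^2" "q^2 < 1" using q by (auto simp: power_less_one_iff)
  have cont: "continuous_on {0<..1} (\<lambda>a. integral {0..2 * pi} (drift a))"
    using integral_continuous_on_param[of "{0<..1}" 0 "2 * pi" drift]
    by (auto intro: continuous_on_subset[OF continuous_on_drift])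
  have "drift 1 = (\<lambda>u. 0)" by (simp add: fun_eq_iff drift_def cos_lat_def)
  then have zero: "integral {0..2 * pi} (drift 1) = 0" by simp
  have int: "drift (q^2) integrable_on {0..2 * pi}"
    using q2 by (intro integrable_continuous_interval continuous_on_drift_slice) auto
  have "((\<lambda>u. sqrt (q^2) / cos_lat (q^2) u - q) has_integral (2 * pi - q * (2 * pi))) {0..2 * pi}"
    using has_integral_const_real[of q 0 "2 * pi"]
    by (intro has_integral_diff has_integral_inverse_cos_lat) (use q2 in \<open>auto simp: mult_ac\<close>)
  \<comment> \<open>The left side is \<open>q * (1 - c) / c\<close>; the drift differs from it by
    the factor \<open>sqrt (1 + c) / sqrt (1 + q^2 * c)\<close>, which is at least 1.\<close>
  moreover have "sqrt (q^2) / cos_lat (q^2) u - q \<le> drift (q^2) u" for u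
  proof -
    define c where "c = cos_lat (q^2) u"
    have c: "0 < c" "c \<le> 1" using cos_lat_bounds[of "q^2" u] q2 by (auto simp: c_def)
    have "q^2 * c \<le> 1 * c" using c q2 by (intro mult_right_mono) auto
    then have "sqrt (1 + q^2 * c) \<le> sqrt (1 + c)" by simp
    moreover have "sqrt (1 + q^2 * c) > 0" using c q2 by (simp add: add_pos_nonneg)
    ultimately have "1 \<le> sqrt (1 + c) / sqrt (1 + q^2 * c)" by simp
    then have "q * (1 - c) / c * 1 \<le> q * (1 - c) / c * (sqrt (1 + c) / sqrt (1 + q^2 * c))"
      using c q by (intro mult_left_mono) auto
    then show ?thesis using c q by (simp add: drift_def c_def[symmetric] field_simps)
  qed
  ultimately have "2 * pi - q * (2 * pi) \<le> integral {0..2 * pi} (drift (q^2))"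
    using int by (intro has_integral_le[OF _ integrable_integral]) auto
  then have "\<alpha> \<le> integral {0..2 * pi} (drift (q^2))" by (simp add: q_def algebra_simps)
  moreover have "continuous_on {q^2..1} (\<lambda>a. integral {0..2 * pi} (drift a))"
    using less_le_trans[OF q2(1)] by (intro continuous_on_subset[OF cont]) auto
  ultimately obtain a where a: "q^2 \<le> a" "a \<le> 1" "integral {0..2 * pi} (drift a) = \<alpha>"
    using IVT2'[of "\<lambda>a. integral {0..2 * pi} (drift a)" 1 \<alpha> "q^2"] zero q2 assms by auto
  moreover have "a \<noteq> 1" using a zero assms by auto
  ultimately show thesis using that[of a] q2 by auto
qed

section \<open>The orbit belonging to a parameter value\<close>

text \<open>The explicit oscillation, run in physical time by inverting the time integral. The last
  clause is kept for identifying the minimal period of the closed orbit.\<close>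

lemma KH_rotating_orbit:
  assumes a: "0 < a" "a < 1"
  obtains r \<theta> z pr pz :: "real \<Rightarrow> real" and n \<tau> :: real
  where "KH_solution (\<lambda>t. r t * cos (\<theta> t)) (\<lambda>t. r t * sin (\<theta> t)) z
      (\<lambda>t. pr t * cos (\<theta> t) - n / r t * sin (\<theta> t))
      (\<lambda>t. pr t * sin (\<theta> t) + n / r t * cos (\<theta> t)) pz"
    and "\<tau> > 0" and "\<And>t. r t > 0"
    and "\<And>t. r (t + \<tau>) = r t" and "\<And>t. z (t + \<tau>) = z t"
    and "\<And>t. pr (t + \<tau>) = pr t" and "\<And>t. pz (t + \<tau>) = pz t"
    and "\<And>t. \<theta> (t + \<tau>) = \<theta> t + integral {0..2 * pi} (drift a)"
    and "\<And>t. 0 < t \<Longrightarrow> r t = r 0 \<Longrightarrow> z t = z 0 \<Longrightarrow> \<exists>N::nat. t = N * \<tau>"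
proof -
  \<comment> \<open>With this \<open>B\<close> the polynomial \<open>c^2 + B * c - 1\<close> factors
    as \<open>(c - a) * (c + 1 / a)\<close>. Since \<open>c - a = \<beta>^2 * (cos u)^2\<close> and
    \<open>1 - c = \<beta>^2 * (sin u)^2\<close>, both \<open>S\<close> and \<open>s\<close> have
    smooth square roots with the right signs; \<open>n\<close> solves
    \<open>4 * pi * n^2 * B = 1\<close>.\<close>
  define B where "B = (1 - a^2) / a"
  define n where "n = 1 / (2 * sqrt (pi * B))"
  define \<beta> where "\<beta> = sqrt (1 - a)"
  define c where "c = cos_lat a"
  define D where "D u = sqrt (1 + c u)" for u
  define E where "E u = sqrt (1 + a * c u)" for u
  define s where "s u = \<beta> * sin u * D u" for u
  define S where "S u = \<beta> * cos u * E u / sqrt a" for u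
  define G where "G u = 2 * c u + B - 2 * S u" for u
  have B: "B > 0" using a by (simp add: B_def power_less_one_iff)
  have n: "n > 0" "4 * pi * n^2 * B = 1"
    using B by (simp_all add: n_def power_mult_distrib power_divide)
  have \<beta>: "\<beta> > 0" "\<beta>^2 = 1 - a" using a by (auto simp: \<beta>_def)
  have c: "0 < c u" "c u \<le> 1" for u using cos_lat_bounds[of a u] a by (auto simp: c_def)
  have c_cos: "c u = a + \<beta>^2 * (cos u)^2" and c_sin: "c u = 1 - (\<beta>^2) * (sin u)^2" for u
    unfolding c_def cos_lat_def \<beta> using sin_cos_squared_add[of u] by algebra+
  have D: "D u > 0" "(D u)^2 = 1 + c u" for u using c[of u] by (auto simp: D_def)
  have E: "E u > 0" "(E u)^2 = 1 + a * c u" for u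
    using c[of u] a by (auto simp: E_def add_pos_pos)
  have s2: "(s u)^2 = (1 - c u) * (1 + c u)" for u
    using D(2)[of u] c_sin[of u] unfolding s_def by algebra
  have cs: "(c u)^2 + (s u)^2 = 1" for u using s2[of u] by algebra
  have aB: "a * B = 1 - a^2" using a by (simp add: B_def)
  have S2: "(S u)^2 = (c u)^2 + B * c u - 1" for u
  proof -
    have "(S u)^2 = (\<beta> * cos u * E u)^2 / a" using a by (simp add: S_def power_divide)
    also have "(\<beta> * cos u * E u)^2 = a * ((c u)^2 + B * c u - 1)"
      using E(2)[of u] c_cos[of u] aB by algebra
    finally show ?thesis using a by simp
  qed
  have G: "G u > 0" for u unfolding G_def using scale_factor_pos[OF c(1) B S2] .
  \<comment> \<open>This is dt/du: comparing the derivatives of \<open>c\<close> gives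
    \<open>sqrt a / (D * E)\<close> for the derivative of sigma by \<open>u\<close>, and dt is
    \<open>G / n\<close> times that of sigma.\<close>
  define f where "f u = G u * sqrt a / (n * D u * E u)" for u
  have f: "f u > 0" for u using G[of u] D(1)[of u] E(1)[of u] n a by (simp add: f_def)
  have cont_c: "continuous_on UNIV c"
    unfolding c_def cos_lat_def by (intro continuous_intros)
  have cont_D: "continuous_on UNIV D" and cont_E: "continuous_on UNIV E"
    unfolding D_def E_def by (intro continuous_intros cont_c)+
  have "n * D u * E u \<noteq> 0" for u using n D(1)[of u] E(1)[of u] by simp
  then have "continuous_on UNIV f"
    unfolding f_def G_def S_def using a by (intro continuous_intros cont_c cont_D cont_E) simp_all
  have per_c: "c (u + 2 * pi) = c u" for u by (simp add: c_def cos_lat_def)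
  have per_s: "s (u + 2 * pi) = s u" and per_S: "S (u + 2 * pi) = S u"
    and per_G: "G (u + 2 * pi) = G u" for u
    by (simp_all add: G_def s_def S_def D_def E_def per_c)
  have "f (u + 2 * pi) = f u" for u by (simp add: f_def per_G D_def E_def per_c)
  with \<open>continuous_on UNIV f\<close> f obtain \<Psi> \<tau> where \<tau>: "\<tau> > 0" and mono: "strict_mono \<Psi>"
    and d\<Psi>: "\<And>t. (\<Psi> has_real_derivative 1 / f (\<Psi> t)) (at t)"
    and per_\<Psi>: "\<And>t. \<Psi> (t + \<tau>) = \<Psi> t + 2 * pi"
    using periodic_time_change[of f "2 * pi"] pi_gt_zero by (metis mult_pos_pos zero_less_numeral)
  have "continuous_on UNIV (drift a)"
    using a by (intro continuous_on_drift_slice) auto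
  moreover have "drift a (u + 2 * pi) = drift a u" for u by (simp add: drift_def cos_lat_def)
  ultimately obtain Th where dTh: "\<And>u. (Th has_real_derivative drift a u) (at u)"
    and per_Th: "\<And>u. Th (u + 2 * pi) = Th u + integral {0..2 * pi} (drift a)"
    using periodic_antiderivative[of "drift a" "2 * pi"] pi_gt_zero
    by (metis mult_pos_pos zero_less_numeral)
  \<comment> \<open>The arctan term is half the latitude, as
    \<open>s / (1 + c) = \<beta> * sin u / D\<close>; it integrates the term \<open>S\<close> and is
    periodic. Only \<open>Th\<close> contributes to the rotation.\<close>
  define \<theta> where "\<theta> u = arctan (\<beta> * sin u / D u) + Th u" for u
  have per_\<theta>: "\<theta> (u + 2 * pi) = \<theta> u + integral {0..2 * pi} (drift a)" for u
    by (simp add: \<theta>_def per_Th D_def per_c)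
  have dc: "(c has_real_derivative - 2 * \<beta>^2 * sin u * cos u) (at u)" for u
    unfolding c_def cos_lat_def \<beta> by (auto intro!: derivative_eq_intros simp: algebra_simps)
  have dD: "(D has_real_derivative - (\<beta>^2) * sin u * cos u / D u) (at u)" for u
    unfolding D_def using c(1)[of u] by (auto intro!: derivative_eq_intros dc simp: field_simps)
  have dE: "(E has_real_derivative - a * \<beta>^2 * sin u * cos u / E u) (at u)" for u
    unfolding E_def using E(1)[of u, unfolded E_def]
    by (auto intro!: derivative_eq_intros dc simp: field_simps)
  have ds: "(s has_real_derivative 2 * c u * \<beta> * cos u / D u) (at u)" for u
  proof -
    have "(s has_real_derivative \<beta> * cos u * D u + - (\<beta>^2) * sin u * cos u / D u * (\<beta> * sin u)) (at u)"
      unfolding s_def by (intro DERIV_mult DERIV_cmult DERIV_sin dD)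
    moreover have "\<beta> * cos u * (D u)^2 + - (\<beta>^2) * sin u * cos u * (\<beta> * sin u)
        = 2 * c u * \<beta> * cos u"
      using D(2)[of u] c_sin[of u] by algebra
    then have "\<beta> * cos u * D u + - (\<beta>^2) * sin u * cos u / D u * (\<beta> * sin u)
        = 2 * c u * \<beta> * cos u / D u"
      using D(1)[of u] by (simp add: field_simps power2_eq_square)
    ultimately show ?thesis by simp
  qed
  have dS: "(S has_real_derivative - (2 * c u + B) * \<beta> * sin u * sqrt a / E u) (at u)" for u
  proof -
    have "(S has_real_derivative (\<beta> * - sin u * E u
        + - a * \<beta>^2 * sin u * cos u / E u * (\<beta> * cos u)) / sqrt a) (at u)"
      unfolding S_def by (intro DERIV_cdivide DERIV_mult DERIV_cmult DERIV_cos dE)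
    moreover have "\<beta> * - sin u * (E u)^2 + - a * \<beta>^2 * sin u * cos u * (\<beta> * cos u)
        = - (2 * c u + B) * \<beta> * sin u * a"
      using E(2)[of u] c_cos[of u] aB by algebra
    then have "\<beta> * - sin u * E u + - a * \<beta>^2 * sin u * cos u / E u * (\<beta> * cos u)
        = - (2 * c u + B) * \<beta> * sin u * a / E u"
      using E(1)[of u] by (simp add: field_simps power2_eq_square)
    moreover have "v * a / E u / sqrt a = v * sqrt a / E u" for v
      using a real_sqrt_mult_self[of a] E(1)[of u] by (simp add: field_simps)
    ultimately show ?thesis by simp
  qed
  have d\<theta>: "(\<theta> has_real_derivative \<beta> * cos u / D u + drift a u) (at u)" for u
  proof -
    have quot: "((\<lambda>u. \<beta> * sin u / D u) has_real_derivative
        (\<beta> * cos u * D u - \<beta> * sin u * (- (\<beta>^2) * sin u * cos u / D u)) / (D u * D u)) (at u)"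
      using D(1)[of u] by (intro DERIV_divide DERIV_cmult DERIV_sin dD) simp
    have "\<beta> * cos u * (D u)^2 - \<beta> * sin u * (- (\<beta>^2) * sin u * cos u) = 2 * \<beta> * cos u"
      using D(2)[of u] c_sin[of u] by algebra
    then have num: "\<beta> * cos u * D u - \<beta> * sin u * (- (\<beta>^2) * sin u * cos u / D u) = 2 * \<beta> * cos u / D u"
      using D(1)[of u] by (simp add: field_simps power2_eq_square)
    have den: "1 + (\<beta> * sin u / D u)^2 = 2 / (D u)^2"
    proof -
      have "(D u)^2 + (\<beta> * sin u)^2 = 2" using D(2)[of u] c_sin[of u] by algebra
      then show ?thesis using D(1)[of u] by (simp add: field_simps)
    qed
    have "((\<lambda>u. arctan (\<beta> * sin u / D u)) has_real_derivative
        inverse (2 / (D u)^2) * (2 * \<beta> * cos u / D u / (D u * D u))) (at u)"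
      using DERIV_chain2[OF DERIV_arctan quot] unfolding num den .
    moreover have "inverse (2 / (D u)^2) * (2 * \<beta> * cos u / D u / (D u * D u)) = \<beta> * cos u / D u"
      using D(1)[of u] by (simp add: power2_eq_square)
    ultimately show ?thesis unfolding \<theta>_def using dTh by (auto intro!: DERIV_add)
  qed
  have chain: "((\<lambda>t. g (\<Psi> t)) has_real_derivative h (\<Psi> t)) (at t)"
    if "\<And>u. (g has_real_derivative g' u) (at u)" "\<And>u. g' u = h u * f u" for g g' h t
    using DERIV_chain2[OF that(1) d\<Psi>, of t] that(2)[of "\<Psi> t"] f[of "\<Psi> t"] by simp
  let ?r = "\<lambda>u. sqrt (G u * c u)"
  let ?pr = "\<lambda>u. n * s u * (c u - S u) / ?r u"
  have "KH_solution (\<lambda>t. ?r (\<Psi> t) * cos (\<theta> (\<Psi> t))) (\<lambda>t. ?r (\<Psi> t) * sin (\<theta> (\<Psi> t)))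
    (\<lambda>t. G (\<Psi> t) * s (\<Psi> t) / 4)
    (\<lambda>t. ?pr (\<Psi> t) * cos (\<theta> (\<Psi> t)) - n / ?r (\<Psi> t) * sin (\<theta> (\<Psi> t)))
    (\<lambda>t. ?pr (\<Psi> t) * sin (\<theta> (\<Psi> t)) + n / ?r (\<Psi> t) * cos (\<theta> (\<Psi> t)))
    (\<lambda>t. 2 * n * (S (\<Psi> t) - c (\<Psi> t)) / G (\<Psi> t))"
    unfolding G_def
  proof (rule KH_solution_reduced[where B = B])
    \<comment> \<open>Passing from t to \<open>u\<close> cancels \<open>n\<close> and
      \<open>G\<close>, so the reduced equations can be checked in the phase alone.\<close>
    have mult_f: "v * n / G u * f u = v * sqrt a / (D u * E u)" for u v
      using G[of u] n by (simp add: f_def)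
    show "((\<lambda>t. c (\<Psi> t)) has_real_derivative
      - 2 * s (\<Psi> t) * S (\<Psi> t) * n / (2 * c (\<Psi> t) + B - 2 * S (\<Psi> t))) (at t)" for t
    proof (rule chain[OF dc])
      show "- 2 * \<beta>^2 * sin u * cos u = - 2 * s u * S u * n / (2 * c u + B - 2 * S u) * f u" for u
        unfolding G_def[symmetric] mult_f unfolding s_def S_def
        using D(1)[of u] E(1)[of u] a by (simp add: power2_eq_square)
    qed
    show "((\<lambda>t. s (\<Psi> t)) has_real_derivative
      2 * c (\<Psi> t) * S (\<Psi> t) * n / (2 * c (\<Psi> t) + B - 2 * S (\<Psi> t))) (at t)" for t
    proof (rule chain[OF ds])
      show "2 * c u * \<beta> * cos u / D u = 2 * c u * S u * n / (2 * c u + B - 2 * S u) * f u" for u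
        unfolding G_def[symmetric] mult_f unfolding S_def
        using D(1)[of u] E(1)[of u] a by simp
    qed
    show "((\<lambda>t. S (\<Psi> t)) has_real_derivative
      - (2 * c (\<Psi> t) + B) * s (\<Psi> t) * n / (2 * c (\<Psi> t) + B - 2 * S (\<Psi> t))) (at t)" for t
    proof (rule chain[OF dS])
      show "- (2 * c u + B) * \<beta> * sin u * sqrt a / E u
          = - (2 * c u + B) * s u * n / (2 * c u + B - 2 * S u) * f u" for u
        unfolding G_def[symmetric] mult_f unfolding s_def
        using D(1)[of u] E(1)[of u] a by simp
    qed
    show "((\<lambda>t. \<theta> (\<Psi> t)) has_real_derivative
      (S (\<Psi> t) + (s (\<Psi> t))^2 / c (\<Psi> t)) * n / (2 * c (\<Psi> t) + B - 2 * S (\<Psi> t))) (at t)" for t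
    proof (rule chain[OF d\<theta>])
      fix u
      have "S u * sqrt a / (D u * E u) = \<beta> * cos u / D u"
        using E(1)[of u] a by (simp add: S_def)
      moreover have "(s u)^2 / c u * sqrt a / (D u * E u) = drift a u"
      proof -
        have "(s u)^2 / c u * sqrt a / (D u * E u) = (1 - c u) * (D u)^2 / c u * sqrt a / (D u * E u)"
          unfolding s2 D(2) ..
        also have "\<dots> = sqrt a * (1 - c u) * D u / (c u * E u)"
          using D(1)[of u] by (simp add: power2_eq_square)
        finally show ?thesis by (simp add: drift_def c_def D_def E_def)
      qed
      ultimately show "\<beta> * cos u / D u + drift a u
          = (S u + (s u)^2 / c u) * n / (2 * c u + B - 2 * S u) * f u"
        unfolding G_def[symmetric] mult_f by (simp only: add_divide_distrib distrib_right)
    qed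
  qed (use c cs S2 n in auto)
  \<comment> \<open>The values of \<open>r\<close> and \<open>z\<close> determine \<open>G\<close>,
    then \<open>c\<close> and \<open>s\<close>, then \<open>S\<close> from the formula for
    \<open>G\<close>, and finally \<open>sin\<close> and \<open>cos\<close> of the phase. So the
    phase has advanced by a multiple of \<open>2 * pi\<close>, positive by monotonicity.\<close>
  moreover have "\<exists>N::nat. t = N * \<tau>"
    if t: "0 < t" "?r (\<Psi> t) = ?r (\<Psi> 0)" "G (\<Psi> t) * s (\<Psi> t) / 4 = G (\<Psi> 0) * s (\<Psi> 0) / 4" for t
  proof -
    have G2: "(G u)^2 = (?r u)^4 + (G u * s u)^2" for u
    proof -
      have "(?r u)^2 = G u * c u" using G[of u] c[of u] by simp
      then have "(?r u)^4 = (G u * c u)^2" by algebra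
      then show ?thesis using cs[of u] by algebra
    qed
    have "(G (\<Psi> t))^2 = (G (\<Psi> 0))^2" unfolding G2 using t by simp
    then have eqG: "G (\<Psi> t) = G (\<Psi> 0)" using G[of "\<Psi> t"] G[of "\<Psi> 0"] by simp
    then have eqs: "s (\<Psi> t) = s (\<Psi> 0)" and eqc: "c (\<Psi> t) = c (\<Psi> 0)"
      using t G[of "\<Psi> 0"] by auto
    have eqS: "S (\<Psi> t) = S (\<Psi> 0)" using eqG eqc unfolding G_def by simp
    have eqDE: "D (\<Psi> t) = D (\<Psi> 0)" "E (\<Psi> t) = E (\<Psi> 0)" using eqc by (simp_all add: D_def E_def)
    have "sin (\<Psi> t) = sin (\<Psi> 0)" "cos (\<Psi> t) = cos (\<Psi> 0)"
      using eqs eqS D(1)[of "\<Psi> 0"] E(1)[of "\<Psi> 0"] \<beta>(1) a by (simp_all add: s_def S_def eqDE)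
    then obtain m :: int where m: "\<Psi> t = \<Psi> 0 + 2 * pi * m"
      by (metis sin_cos_eq_iff)
    have "\<Psi> 0 < \<Psi> t" using mono t(1) by (simp add: strict_mono_def)
    then have "m > 0" using m by (simp add: zero_less_mult_iff)
    then obtain N :: nat where N: "m = int N" by (metis zero_less_imp_eq_int)
    have "\<Psi> (of_nat N * \<tau>) = \<Psi> 0 + 2 * pi * of_nat N" for N
    proof (induction N)
      case (Suc N)
      then show ?case using per_\<Psi>[of "of_nat N * \<tau>"] by (simp add: algebra_simps)
    qed simp
    then have "\<Psi> t = \<Psi> (N * \<tau>)" using m N by simp
    then show ?thesis using mono by (metis strict_mono_eq)
  qed
  ultimately show thesis
    using that[of "\<lambda>t. ?r (\<Psi> t)" "\<lambda>t. \<theta> (\<Psi> t)" "\<lambda>t. G (\<Psi> t) * s (\<Psi> t) / 4"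
        "\<lambda>t. ?pr (\<Psi> t)" n "\<lambda>t. 2 * n * (S (\<Psi> t) - c (\<Psi> t)) / G (\<Psi> t)" \<tau>]
      \<tau> G c by (simp add: per_\<Psi> per_c per_s per_S per_G per_\<theta>)
qed

section \<open>Closing up after k oscillations\<close>

text \<open>One oscillation turns the orbit by \<open>2 * pi * j / k\<close>, so \<open>k\<close> of
  them close it. A shorter period would consist of \<open>N < k\<close> oscillations with
  \<open>k\<close> dividing \<open>N * j\<close>, which coprimality rules out. The strict bound on
  \<open>j\<close> keeps the angle in the range where a parameter \<open>a\<close> is
  available.\<close>

lemma KH_rational_rotation:
  fixes j k :: nat
  assumes "0 < j" and "j < k" and "coprime j k"
  obtains x y z px py pz :: "real \<Rightarrow> real" and T :: real
  where "KH_solution x y z px py pz" "T > 0" "KH_periodic_with x y z px py pz T"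
    "\<And>s. 0 < s \<Longrightarrow> s < T \<Longrightarrow> \<not> KH_periodic_with x y z px py pz s"
    "\<And>t. x (t + T / k) = cos (2 * pi * j / k) * x t - sin (2 * pi * j / k) * y t"
    "\<And>t. y (t + T / k) = sin (2 * pi * j / k) * x t + cos (2 * pi * j / k) * y t"
proof -
  define \<alpha> where "\<alpha> = 2 * pi * j / k"
  have "0 < \<alpha>" "\<alpha> < 2 * pi" using assms by (auto simp: \<alpha>_def field_simps)
  then obtain a where a: "0 < a" "a < 1" "integral {0..2 * pi} (drift a) = \<alpha>"
    using total_drift_attained by blast
  obtain r \<theta> z pr pz n \<tau>
    where sol: "KH_solution (\<lambda>t. r t * cos (\<theta> t)) (\<lambda>t. r t * sin (\<theta> t)) z
      (\<lambda>t. pr t * cos (\<theta> t) - n / r t * sin (\<theta> t))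
      (\<lambda>t. pr t * sin (\<theta> t) + n / r t * cos (\<theta> t)) pz"
    and \<tau>: "\<tau> > 0" and r: "\<And>t. r t > 0"
    and per: "\<And>t. r (t + \<tau>) = r t" "\<And>t. z (t + \<tau>) = z t"
      "\<And>t. pr (t + \<tau>) = pr t" "\<And>t. pz (t + \<tau>) = pz t"
    and per_\<theta>: "\<And>t. \<theta> (t + \<tau>) = \<theta> t + \<alpha>"
    and minimal: "\<And>t. 0 < t \<Longrightarrow> r t = r 0 \<Longrightarrow> z t = z 0 \<Longrightarrow> \<exists>N::nat. t = N * \<tau>"
    by (rule KH_rotating_orbit[OF a(1,2), unfolded a(3)]) (rule that)
  have iter: "r (t + N * \<tau>) = r t \<and> z (t + N * \<tau>) = z t \<and> pr (t + N * \<tau>) = pr t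
      \<and> pz (t + N * \<tau>) = pz t \<and> \<theta> (t + N * \<tau>) = \<theta> t + N * \<alpha>" for t and N :: nat
  proof (induction N)
    case (Suc N)
    have "t + real (Suc N) * \<tau> = (t + N * \<tau>) + \<tau>" by (simp add: algebra_simps)
    then show ?case using Suc by (simp only: per per_\<theta>) (simp add: algebra_simps)
  qed simp
  have k\<alpha>: "k * \<alpha> = 2 * pi * j" using assms by (simp add: \<alpha>_def)
  define x y px py where defs: "x = (\<lambda>t. r t * cos (\<theta> t))" "y = (\<lambda>t. r t * sin (\<theta> t))"
    "px = (\<lambda>t. pr t * cos (\<theta> t) - n / r t * sin (\<theta> t))"
    "py = (\<lambda>t. pr t * sin (\<theta> t) + n / r t * cos (\<theta> t))"
  show thesis
  proof (rule that[of x y z px py pz "k * \<tau>"])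
    show "KH_solution x y z px py pz" using sol by (simp add: defs)
    show "k * \<tau> > 0" using assms \<tau> by simp
    have "cos (\<theta> (t + k * \<tau>)) = cos (\<theta> t)" "sin (\<theta> (t + k * \<tau>)) = sin (\<theta> t)" for t
      using iter[of t k] k\<alpha> sin_cos_eq_iff[of "\<theta> t + 2 * pi * j" "\<theta> t"]
      by (metis of_int_of_nat_eq)+
    then show "KH_periodic_with x y z px py pz (k * \<tau>)"
      unfolding KH_periodic_with_def defs using iter[of _ k] by simp
    have shift: "t + k * \<tau> / k = t + \<tau>" for t using assms by simp
    show "x (t + k * \<tau> / k) = cos (2 * pi * j / k) * x t - sin (2 * pi * j / k) * y t"
      "y (t + k * \<tau> / k) = sin (2 * pi * j / k) * x t + cos (2 * pi * j / k) * y t" for t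
      unfolding \<alpha>_def[symmetric] shift defs per per_\<theta> cos_add sin_add
      by (simp_all add: algebra_simps)
    fix s assume s: "0 < s" "s < k * \<tau>"
    show "\<not> KH_periodic_with x y z px py pz s"
    proof
      assume "KH_periodic_with x y z px py pz s"
      then have eq: "x s = x 0" "y s = y 0" "z s = z 0"
        unfolding KH_periodic_with_def by (metis add_0)+
      \<comment> \<open>Comparing positions at times 0 and \<open>s\<close> is enough: they give
        \<open>r\<close> and \<open>z\<close>, hence a whole number of oscillations, and then the
        angle modulo \<open>2 * pi\<close>.\<close>
      have "(r t)^2 = (x t)^2 + (y t)^2" for t
        by (simp add: defs power_mult_distrib flip: distrib_left)
      then have "(r s)^2 = (r 0)^2" using eq by simp
      then have eqr: "r s = r 0" using r[of s] r[of 0] by simp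
      then obtain N :: nat where N: "s = N * \<tau>" using minimal s(1) eq(3) by blast
      have "cos (\<theta> s) = cos (\<theta> 0)" "sin (\<theta> s) = sin (\<theta> 0)"
        using eq eqr r[of 0] by (auto simp: defs)
      then obtain m :: int where "\<theta> s = \<theta> 0 + 2 * pi * m" by (metis sin_cos_eq_iff)
      then have "N * \<alpha> = 2 * pi * m" using iter[of 0 N] N by simp
      then have "real N * real j = real_of_int m * real k"
        using assms by (simp add: \<alpha>_def field_simps)
      then have "int N * int j = m * int k"
        by (metis of_int_eq_iff of_int_mult of_int_of_nat_eq)
      then have "int k dvd int (N * j)" by (metis dvd_triv_right of_nat_mult)
      then have "k dvd N * j" by (simp only: int_dvd_int_iff)
      then have "k dvd N" using assms(3) by (metis coprime_commute coprime_dvd_mult_left_iff)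
      moreover have "0 < N" "N < k" using s N \<tau> by (auto simp: zero_less_mult_iff)
      ultimately show False using dvd_imp_le by fastforce
    qed
  qed
qed

theorem mainTheorem7:
  fixes j k :: nat
  assumes "0 < j" and "j \<le> k" and "coprime j k"
  shows "\<exists>x y z px py pz :: real \<Rightarrow> real. \<exists>T :: real.
    KH_solution x y z px py pz \<and>
    T > 0 \<and> KH_periodic_with x y z px py pz T \<and>
    (\<forall>s. 0 < s \<and> s < T \<longrightarrow> \<not> KH_periodic_with x y z px py pz s) \<and>
    (\<forall>t. x (t + T / k) = cos (2 * pi * j / k) * x t - sin (2 * pi * j / k) * y t \<and>
         y (t + T / k) = sin (2 * pi * j / k) * x t + cos (2 * pi * j / k) * y t)"
proof (cases "j < k")
  case True
  then show ?thesis using KH_rational_rotation[OF assms(1) True assms(3)] by metis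
next
  case False
  then have jk: "j = k" "k = 1" using assms by auto
  \<comment> \<open>For \<open>j = k = 1\<close> the rotation is the identity, so any orbit with its
    minimal period serves; the one with rotation number 1/2 is taken.\<close>
  have "0 < (1::nat)" "1 < (2::nat)" "coprime 1 (2::nat)" by simp_all
  then obtain x y z px py pz T where *: "KH_solution x y z px py pz" "T > 0"
    "KH_periodic_with x y z px py pz T"
    "\<And>s. 0 < s \<Longrightarrow> s < T \<Longrightarrow> \<not> KH_periodic_with x y z px py pz s"
    using KH_rational_rotation by metis
  then have "x (t + T) = x t" "y (t + T) = y t" for t by (auto simp: KH_periodic_with_def)
  then have "x (t + T / 1) = cos (2 * pi * 1 / 1) * x t - sin (2 * pi * 1 / 1) * y t \<and>
      y (t + T / 1) = sin (2 * pi * 1 / 1) * x t + cos (2 * pi * 1 / 1) * y t" for t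
    by simp
  with * show ?thesis unfolding jk of_nat_1 by metis
qed

end
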